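(* Let $p=2k\ge2$ be an even integer, $x\in C([0,T];\mathbb R^d)$ and $N=\dim\operatorname{Sym}^p(\mathbb R^d)=\binom{d+p-1}{p}$. Assume there exist vectors $v_1,\dots,v_N\in\mathbb R^d$ such that $\{v_r^{\otimes p}:1\le r\le N\}$ is a basis of $\operatorname{Sym}^p(\mathbb R^d)$, and functions $A_r\in C([0,T],\mathbb R_+)$ with $A_r(0)=0$ such that the scalar projections $x_r=x\cdot v_r$ satisfy, for $1\le r\le N$, $$\sup_{0<\ell\le\delta}\sup_{0\le a<\ell}\sup_{t\in[0,T]}\left|\mathsf V^p_{\Pi(\ell,a)}(x_r;t)-A_r(t)\right|\longrightarrow0\qquad(\delta\downarrow0).$$ (The functions $A_r$ are allowed to vanish.) Then there exists a unique continuous function of bounded variation $Q^{(p)}\in C([0,T],\operatorname{Sym}^p(\mathbb R^d))$, $Q^{(p)}(0)=0$, such that, for any tensor norm, $$\lim_{\delta\downarrow0}\sup_{0<\ell\le\delta}\sup_{0\le a<\ell}\sup_{t\in[0,T]}\left\|Q^{(p)}_{\Pi(\ell,a)}(x;t)-Q^{(p)}(t)\right\|=0,$$ and the following properties hold: 1. Every linear projection $v\cdot x$, $v\in\mathbb R^d$, has a continuous limiting $p$-energy, uniformly over shifted uniform grids and stopping times (i.e. $\sup_{0<\ell\le\delta}\sup_{0\le a<\ell}\sup_{t}|\mathsf V^p_{\Pi(\ell,a)}(v\cdot x;t)-A_v(t)|\to0$ as $\delta\downarrow0$), given by $A_v(t):=Q^{(p)}(t)[v,\dots,v]$. In particular $A_{v_r}=A_r$.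 2. For any $v_1',\dots,v_p'\in\mathbb R^d$, $$Q^{(p)}(t)[v_1',\dots,v_p']=\frac1{p!}\sum_{J\subseteq\{1,\dots,p\}}(-1)^{p-|J|}A_{\sum_{j\in J}v_j'}(t),$$ where $A_0=0$. 3. For $0\le s<t\le T$, the increment $Q^{(p)}(t)-Q^{(p)}(s)$ belongs to the closed convex cone $\mathcal K_p:=\overline{\operatorname{cone}\{z^{\otimes p}:z\in\mathbb R^d\}}$. Consequently, every $A_v$ is nondecreasing. 4. The Euclidean scalar $p$-energy $\mathsf V^p_{\Pi(\ell,a),\mathrm{sc}}(x;t)$ of $x$ converges uniformly over shifted uniform grids and stopping times as the mesh tends to $0$. Its limit is $$A_{\mathrm{sc}}(t):=\sum_{i_1,\dots,i_k=1}^dQ^{(p)}(t)[e_{i_1},e_{i_1},\dots,e_{i_k},e_{i_k}],$$ where $(e_1,\dots,e_d)$ is the canonical basis. If $A_r(T)>0$ for at least one $r$, i.e. $x_r$ is $p$-rough, then $x\in\mathscr R^{\mathrm{sc}}_p([0,T];\mathbb R^d)$ and $[x]^p_{\mathrm{sc}}=A_{\mathrm{sc}}$.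
   Context: For a partition $\pi=\{0=t_0<\dots<t_M=T\}$ of $[0,T]$: for scalar $y$, $\mathsf V^p_\pi(y;t):=\sum_{j}|y(t_{j+1}\wedge t)-y(t_j\wedge t)|^p$; for $x\in C([0,T];\mathbb R^d)$, $\mathsf V^p_{\pi,\mathrm{sc}}(x;t):=\sum_j\|x(t_{j+1}\wedge t)-x(t_j\wedge t)\|^p$ (Euclidean norm), and $Q^{(p)}_\pi(x;t):=\sum_{j=0}^{M-1}\bigl(x(t_{j+1}\wedge t)-x(t_j\wedge t)\bigr)^{\otimes p}$. $\operatorname{Sym}^p(\mathbb R^d)$ is the space of symmetric $p$-tensors; $S[w_1,\dots,w_p]$ denotes the contraction of $S$ with $w_1\otimes\dots\otimes w_p$, viewing $S$ as a symmetric $p$-linear form, so that $z^{\otimes p}[w_1,\dots,w_p]=\prod_j z\cdot w_j$. Shifted uniform grids: for $0<\ell\le T$, $0\le a<\ell$, $\Pi(\ell,a):=\{0,T\}\cup\{a+k\ell:k\in\mathbb Z,\ 0<a+k\ell<T\}$. A scalar continuous path $y$ is $p$-rough if $\sup_{0<\ell\le\delta}\sup_{0\le a<\ell}\sup_{t}|\mathsf V^p_{\Pi(\ell,a)}(y;t)-A(t)|\to0$ as $\delta\downarrow0$ for some continuous nondecreasing $A$ with $A(T)>A(0)=0$. $\mathscr R^{\mathrm{sc}}_p([0,T];\mathbb R^d)$ is the class of $x\in C([0,T];\mathbb R^d)$ for which there is a continuous nondecreasing $[x]^p_{\mathrm{sc}}:[0,T]\to\mathbb R_+$ with $[x]^p_{\mathrm{sc}}(0)=0$,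 $[x]^p_{\mathrm{sc}}(T)>0$ and $\sup_{0<\ell\le\delta}\sup_{0\le a<\ell}\sup_{t}|\mathsf V^p_{\Pi(\ell,a),\mathrm{sc}}(x;t)-[x]^p_{\mathrm{sc}}(t)|\to0$ as $\delta\downarrow0$. *)

theory Defs
  imports "HOL-Analysis.Analysis"
begin

section \<open>Partitions, shifted uniform grids and limits along them\<close>

text \<open>A partition of \<open>[0,T]\<close> is represented by the finite set of its points;
  \<open>node P j\<close> is the \<open>j\<close>-th point in increasing order, starting with \<open>j = 0\<close>.\<close>

definition node :: "real set \<Rightarrow> nat \<Rightarrow> real" where
  "node P j = sorted_list_of_set P ! j"

definition shifted_grid :: "real \<Rightarrow> real \<Rightarrow> real \<Rightarrow> real set" where
  "shifted_grid T l a =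
     {0, T} \<union> {a + of_int k * l |k :: int. 0 < a + of_int k * l \<and> a + of_int k * l < T}"

lemma finite_shifted_grid:
  assumes "l > 0"
  shows "finite (shifted_grid T l a)"
proof -
  have sub: "{a + of_int k * l |k :: int. 0 < a + of_int k * l \<and> a + of_int k * l < T}
      \<subseteq> (\<lambda>k. a + of_int k * l) ` {\<lfloor>- a / l\<rfloor> .. \<lceil>(T - a) / l\<rceil>}"
  proof safe
    fix k :: int
    assume k: "0 < a + of_int k * l" "a + of_int k * l < T"
    have "- a / l \<le> of_int k" "of_int k \<le> (T - a) / l"
      using k assms by (simp_all add: field_simps)
    then have "k \<in> {\<lfloor>- a / l\<rfloor> .. \<lceil>(T - a) / l\<rceil>}"
      by (auto simp: floor_le_iff le_ceiling_iff)
    then show "a + of_int k * l \<in> (\<lambda>k. a + of_int k * l) ` {\<lfloor>- a / l\<rfloor> .. \<lceil>(T - a) / l\<rceil>}"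
      by blast
  qed
  show ?thesis
    unfolding shifted_grid_def using finite_subset[OF sub] by simp
qed

text \<open>\<open>grid_vanishes T D\<close> says that
  \<open>sup\<^bsub>0<l\<le>\<delta>\<^esub> sup\<^bsub>0\<le>a<l\<^esub> sup\<^bsub>0\<le>t\<le>T\<^esub> D (shifted_grid T l a) t\<close> tends to \<open>0\<close> as \<open>\<delta> \<down> 0\<close>,
  for a nonnegative discrepancy \<open>D\<close>. The suprema may be infinite, so they are taken in
  \<^typ>\<open>ennreal\<close>. The restriction \<open>l \<le> T\<close> is immaterial, since only small \<open>\<delta>\<close> matter.\<close>

definition grid_vanishes :: "real \<Rightarrow> (real set \<Rightarrow> real \<Rightarrow> real) \<Rightarrow> bool" where
  "grid_vanishes T D \<longleftrightarrow>
     ((\<lambda>\<delta>. SUP l\<in>{0<..\<delta>}. SUP a\<in>{0..<l}. SUP t\<in>{0..T}. ennreal (D (shifted_grid T l a) t))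
        \<longlongrightarrow> 0) (at_right 0)"

section \<open>\<open>p\<close>-energies and rough paths\<close>

text \<open>For scalar paths the norm is the absolute value, and for paths in \<open>real ^ 'd\<close> it is the
  Euclidean norm; hence this one definition gives both the scalar \<open>p\<close>-variation of a
  real path and the Euclidean scalar \<open>p\<close>-energy of a vector path.\<close>

definition energy :: "nat \<Rightarrow> real set \<Rightarrow> (real \<Rightarrow> 'a::real_normed_vector) \<Rightarrow> real \<Rightarrow> real" where
  "energy p P y t =
     (\<Sum>j<card P - 1. norm (y (min (node P (Suc j)) t) - y (min (node P j) t)) ^ p)"

definition has_energy ::
  "real \<Rightarrow> nat \<Rightarrow> (real \<Rightarrow> 'a::real_normed_vector) \<Rightarrow> (real \<Rightarrow> real) \<Rightarrow> bool" where
  "has_energy T p y A \<longleftrightarrow> grid_vanishes T (\<lambda>P t. \<bar>energy p P y t - A t\<bar>)"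

definition has_rough_energy ::
  "real \<Rightarrow> nat \<Rightarrow> (real \<Rightarrow> 'a::real_normed_vector) \<Rightarrow> (real \<Rightarrow> real) \<Rightarrow> bool" where
  "has_rough_energy T p y A \<longleftrightarrow>
     continuous_on {0..T} A \<and> mono_on {0..T} A \<and> (\<forall>t\<in>{0..T}. 0 \<le> A t) \<and>
     A 0 = 0 \<and> 0 < A T \<and> has_energy T p y A"

definition p_rough :: "real \<Rightarrow> nat \<Rightarrow> (real \<Rightarrow> real) \<Rightarrow> bool" where
  "p_rough T p y \<longleftrightarrow> continuous_on {0..T} y \<and> (\<exists>A. has_rough_energy T p y A)"

definition rough_sc :: "real \<Rightarrow> nat \<Rightarrow> (real \<Rightarrow> real ^ 'd) set" where
  "rough_sc T p = {x. continuous_on {0..T} x \<and> (\<exists>A. has_rough_energy T p x A)}"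

text \<open>For \<open>x \<in> rough_sc T p\<close> the function below is determined on \<open>{0..T}\<close>,
  being a uniform limit; its values outside \<open>{0..T}\<close> are arbitrary.\<close>

definition bracket_sc :: "real \<Rightarrow> nat \<Rightarrow> (real \<Rightarrow> real ^ 'd) \<Rightarrow> real \<Rightarrow> real" where
  "bracket_sc T p x = (SOME A. has_rough_energy T p x A)"

section \<open>Symmetric tensors\<close>

text \<open>The tensors of order \<open>p\<close> over \<open>real ^ 'd\<close> are given by their coordinates in the canonical
  basis. The \<open>p\<close> slots are indexed by a finite type \<open>'p\<close> with \<open>CARD('p) = p\<close>, so a
  multi-index is a function \<open>'p \<Rightarrow> 'd\<close>.\<close>

type_synonym ('p, 'd) tensor = "real ^ ('p \<Rightarrow> 'd)"

definition tensor_pow :: "real ^ 'd \<Rightarrow> ('p::finite, 'd::finite) tensor" where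
  "tensor_pow z = (\<chi> i. \<Prod>q\<in>UNIV. z $ i q)"

definition sym_tensors :: "('p::finite, 'd::finite) tensor set" where
  "sym_tensors = {S. \<forall>\<sigma>. bij \<sigma> \<longrightarrow> (\<forall>i. S $ (i \<circ> \<sigma>) = S $ i)}"

definition contract :: "('p::finite, 'd::finite) tensor \<Rightarrow> ('p \<Rightarrow> real ^ 'd) \<Rightarrow> real" where
  "contract S w = (\<Sum>i\<in>UNIV. S $ i * (\<Prod>q\<in>UNIV. w q $ i q))"

lemma contract_tensor_pow: "contract (tensor_pow z) w = (\<Prod>q\<in>UNIV. z \<bullet> w q)"
  by (simp add: contract_def tensor_pow_def inner_vec_def prod_sum_PiE prod.distrib)

definition norm_on :: "'a::real_vector set \<Rightarrow> ('a \<Rightarrow> real) \<Rightarrow> bool" where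
  "norm_on V \<nu> \<longleftrightarrow>
     (\<forall>S\<in>V. 0 \<le> \<nu> S \<and> (\<nu> S = 0 \<longleftrightarrow> S = 0)) \<and>
     (\<forall>c. \<forall>S\<in>V. \<nu> (c *\<^sub>R S) = \<bar>c\<bar> * \<nu> S) \<and>
     (\<forall>S\<in>V. \<forall>S'\<in>V. \<nu> (S + S') \<le> \<nu> S + \<nu> S')"

definition power_cone :: "('p::finite, 'd::finite) tensor set" where
  "power_cone = closure (convex_cone hull (range tensor_pow))"

section \<open>The tensor energy\<close>

definition tensor_energy ::
  "real set \<Rightarrow> (real \<Rightarrow> real ^ 'd) \<Rightarrow> real \<Rightarrow> ('p::finite, 'd::finite) tensor" where
  "tensor_energy P x t =
     (\<Sum>j<card P - 1. tensor_pow (x (min (node P (Suc j)) t) - x (min (node P j) t)))"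

definition bounded_variation :: "real \<Rightarrow> (real \<Rightarrow> 'a::real_normed_vector) \<Rightarrow> bool" where
  "bounded_variation T f \<longleftrightarrow>
     (\<exists>B. \<forall>P. finite P \<and> {0, T} \<subseteq> P \<and> P \<subseteq> {0..T} \<longrightarrow>
        (\<Sum>j<card P - 1. norm (f (node P (Suc j)) - f (node P j))) \<le> B)"

definition is_tensor_energy ::
  "real \<Rightarrow> (real \<Rightarrow> real ^ 'd) \<Rightarrow> (real \<Rightarrow> ('p::finite, 'd::finite) tensor) \<Rightarrow> bool" where
  "is_tensor_energy T x Q \<longleftrightarrow>
     (\<forall>t\<in>{0..T}. Q t \<in> sym_tensors) \<and> continuous_on {0..T} Q \<and> bounded_variation T Q \<and>
     Q 0 = 0 \<and>
     (\<forall>\<nu>. norm_on (sym_tensors :: ('p, 'd) tensor set) \<nu> \<longrightarrow>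
        grid_vanishes T (\<lambda>P t. \<nu> (tensor_energy P x t - Q t)))"

end

theory Submission
  imports Defs
begin

text \<open>Contracting a tensor with \<open>u, \<dots>, u\<close> is the inner product with \<open>u\<^sup>\<otimes>\<^sup>p\<close>, so the \<open>p\<close>-energy of
  \<open>u \<bullet> x\<close> along a grid is the inner product of the tensor energy with \<open>u\<^sup>\<otimes>\<^sup>p\<close>. Hence, if \<open>D\<^sub>r\<close> is the
  basis of the symmetric tensors dual to \<open>v\<^sub>r\<^sup>\<otimes>\<^sup>p\<close>, the tensor energy minus \<open>Q = \<Sum>\<^sub>r A\<^sub>r D\<^sub>r\<close> is a
  combination of the \<open>D\<^sub>r\<close> whose coefficients vanish by hypothesis. Increments of tensor energies along
  grids through \<open>s\<close> are sums of tensor powers, which places the increments of \<open>Q\<close> in the closed cone.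
  On that cone the norm is bounded by the linear functional \<open>tensor_trace\<close> (they agree on
  tensor powers); this gives bounded variation and the positivity of the limiting Euclidean energy.\<close>

section \<open>Symmetric tensors\<close>

lemma contract_eq_inner: "contract S w = S \<bullet> (\<chi> i. \<Prod>q\<in>UNIV. w q $ i q)"
  by (simp add: contract_def inner_vec_def)

lemma contract_diagonal: "contract S (\<lambda>_. u) = S \<bullet> tensor_pow u"
  by (simp add: contract_eq_inner tensor_pow_def)

lemma inner_tensor_pow:
  "(tensor_pow z :: ('p::finite, 'd::finite) tensor) \<bullet> tensor_pow u = (z \<bullet> u) ^ CARD('p)"
  by (simp add: contract_diagonal[symmetric] contract_tensor_pow)

lemma norm_tensor_pow: "norm (tensor_pow z :: ('p::finite, 'd::finite) tensor) = norm z ^ CARD('p)"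
  by (simp add: norm_eq_sqrt_inner inner_tensor_pow real_sqrt_power)

lemma tensor_pow_0 [simp]: "(tensor_pow 0 :: ('p::finite, 'd::finite) tensor) = 0"
  by (simp add: tensor_pow_def vec_eq_iff)

lemma tensor_pow_sym: "(tensor_pow z :: ('p::finite, 'd::finite) tensor) \<in> sym_tensors"
  unfolding sym_tensors_def tensor_pow_def
  by (auto intro!: prod.reindex_bij_betw[of _ UNIV UNIV "\<lambda>q. z $ _ q"])

lemma subspace_sym_tensors: "subspace sym_tensors"
  by (auto simp: subspace_def sym_tensors_def)

section \<open>Dimension of the space of symmetric tensors\<close>

lemma sym_tensors_image_mset:
  fixes S :: "('p::finite, 'd::finite) tensor"
  assumes "S \<in> sym_tensors"
    and "image_mset i (mset_set UNIV) = image_mset j (mset_set UNIV)"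
  shows "S $ i = S $ j"
proof -
  \<comment> \<open>Multi-indices that take the same values with the same multiplicities differ by a
    permutation of the slots.\<close>
  obtain \<sigma> where \<sigma>: "\<sigma> permutes UNIV" "\<And>q. i q = j (\<sigma> q)"
    using image_mset_eq_implies_permutes[OF _ assms(2)] by auto
  then have "i = j \<circ> \<sigma>" "bij \<sigma>"
    by (auto simp: permutes_bij)
  then show ?thesis
    using assms(1) by (auto simp: sym_tensors_def)
qed

text \<open>Slot permutations act on multi-indices, and an orbit is determined by its multiset of
  values. This is the indicator of the orbit of \<open>M\<close>; it is zero when the size of
  \<open>M\<close> is not the tensor order.\<close>

definition orbit_tensor :: "'d multiset \<Rightarrow> ('p::finite, 'd::finite) tensor" where
  "orbit_tensor M = (\<chi> i. of_bool (image_mset i (mset_set UNIV) = M))"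

lemma ex_image_mset_eq:
  fixes M :: "'d multiset"
  assumes "size M = CARD('p::finite)"
  shows "\<exists>i :: 'p \<Rightarrow> 'd. image_mset i (mset_set UNIV) = M"
proof -
  obtain xs where xs: "mset xs = M"
    using ex_mset by blast
  then have len: "length xs = CARD('p)"
    using assms by auto
  obtain f :: "'p \<Rightarrow> nat" where f: "bij_betw f UNIV {0..<CARD('p)}"
    using ex_bij_betw_finite_nat[of "UNIV :: 'p set"] by auto
  have "image_mset (\<lambda>q. xs ! f q) (mset_set UNIV)
      = image_mset ((!) xs) (image_mset f (mset_set UNIV))"
    by (simp add: multiset.map_comp o_def)
  also have "image_mset f (mset_set UNIV) = mset_set {0..<length xs}"
    using f len by (simp add: image_mset_mset_set bij_betw_def)
  also have "image_mset ((!) xs) \<dots> = mset xs"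
    by (metis map_nth mset_map mset_upt)
  finally show ?thesis
    using xs by blast
qed

text \<open>Orbit indicators have disjoint supports, so they are orthogonal, and they span because a
  symmetric tensor is constant on each orbit. The dimension is therefore the number of multisets of
  size \<open>CARD('p)\<close> over the coordinates.\<close>

lemma dim_sym_tensors:
  "dim (sym_tensors :: ('p::finite, 'd::finite) tensor set)
     = (CARD('d) + CARD('p) - 1) choose CARD('p)"
proof -
  let ?\<M> = "multisets_of_size (UNIV :: 'd set) CARD('p)"
  let ?E = "orbit_tensor :: 'd multiset \<Rightarrow> ('p, 'd) tensor"
  have fin: "finite ?\<M>"
    by auto
  have self: "?E M $ i = 1" if "image_mset i (mset_set UNIV) = M" for M i
    using that by (simp add: orbit_tensor_def)
  have orth: "?E M \<bullet> ?E M' = 0" if "M \<noteq> M'" for M M'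
    using that by (auto simp: orbit_tensor_def inner_vec_def intro!: sum.neutral)
  have nz: "?E M \<noteq> 0" if M: "M \<in> ?\<M>" for M
  proof -
    obtain i :: "'p \<Rightarrow> 'd" where "image_mset i (mset_set UNIV) = M"
      using M ex_image_mset_eq[where 'p = 'p, of M] by (auto simp: multisets_of_size_def)
    then show ?thesis
      using self[of i M] by auto
  qed
  \<comment> \<open>A common image of two distinct multisets would be orthogonal to itself, hence
    zero.\<close>
  have inj: "inj_on ?E ?\<M>"
    by (rule inj_onI) (metis orth nz inner_eq_zero_iff)
  have ind: "independent (?E ` ?\<M>)"
    by (rule pairwise_orthogonal_independent)
      (use nz in \<open>auto simp: pairwise_def orthogonal_def intro!: orth\<close>)
  have sub: "?E ` ?\<M> \<subseteq> sym_tensors"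
  proof safe
    fix M
    have "image_mset (i \<circ> \<sigma>) (mset_set UNIV) = image_mset i (mset_set UNIV)"
      if "bij \<sigma>" for i :: "'p \<Rightarrow> 'd" and \<sigma>
      using that
      by (metis bij_betw_def image_mset_mset_set multiset.map_comp)
    then show "?E M \<in> sym_tensors"
      by (auto simp: sym_tensors_def orbit_tensor_def)
  qed
  have gen: "sym_tensors \<subseteq> span (?E ` ?\<M>)"
  proof
    fix S :: "('p, 'd) tensor"
    assume S: "S \<in> sym_tensors"
    \<comment> \<open>The value of \<open>S\<close> on an orbit, read off at an arbitrary
      representative; symmetry makes the choice irrelevant.\<close>
    define c where "c M = S $ (SOME i. image_mset i (mset_set UNIV) = M)" for M
    have c: "c (image_mset i (mset_set UNIV)) = S $ i" for i
      unfolding c_def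
      by (rule sym_tensors_image_mset[OF S],
          rule someI[of "\<lambda>j. image_mset j (mset_set UNIV) = image_mset i (mset_set UNIV)"])
        (rule refl)
    have "S = (\<Sum>M\<in>?\<M>. c M *\<^sub>R ?E M)"
    proof (rule vec_eq_iff[THEN iffD2], rule allI)
      fix i :: "'p \<Rightarrow> 'd"
      have "(\<Sum>M\<in>?\<M>. c M *\<^sub>R ?E M) $ i
          = (\<Sum>M\<in>?\<M>. if M = image_mset i (mset_set UNIV) then c M else 0)"
        by (auto simp: orbit_tensor_def intro!: sum.cong)
      also have "\<dots> = S $ i"
        using fin c by (simp add: multisets_of_size_def)
      finally show "S $ i = (\<Sum>M\<in>?\<M>. c M *\<^sub>R ?E M) $ i" ..
    qed
    then show "S \<in> span (?E ` ?\<M>)"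
      by (metis (no_types, lifting) span_sum span_scale span_base imageI)
  qed
  have "dim (sym_tensors :: ('p, 'd) tensor set) = card (?E ` ?\<M>)"
    by (rule dim_unique[OF sub gen ind refl])
  then show ?thesis
    using inj by (simp add: card_image card_multisets_of_size)
qed

section \<open>Polarization\<close>

text \<open>If \<open>U\<close> is a proper subset of \<open>S\<close>, the sets between them of
  even and of odd size are equally many, so the signs cancel.\<close>

lemma sum_alternating_supersets:
  assumes "finite S" "U \<subseteq> S"
  shows "(\<Sum>J | J \<subseteq> S \<and> U \<subseteq> J. (-1) ^ (card S - card J)) = (of_bool (U = S) :: real)"
proof (cases "U = S")
  case True
  then have "{J. J \<subseteq> S \<and> U \<subseteq> J} = {S}"
    by auto
  then show ?thesis
    using True by simp
next
  case False
  have "(-1 :: real) ^ (card S - card J) = (-1) ^ card S * (-1) ^ card J" if "J \<subseteq> S" for J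
    using card_mono[OF assms(1) that] by (simp add: minus_one_power_iff)
  then have "(\<Sum>J | J \<subseteq> S \<and> U \<subseteq> J. (-1) ^ (card S - card J))
      = (-1) ^ card S * (\<Sum>J | J \<subseteq> S \<and> U \<subseteq> J. (-1 :: real) ^ card J)"
    by (simp add: sum_distrib_left)
  also have "(\<Sum>J | J \<subseteq> S \<and> U \<subseteq> J. (-1 :: real) ^ card J) = 0"
    using card_subsupersets_even_odd[of S U] assms False
    by (intro sum_alternating_cancels) (auto simp: conj_assoc)
  finally show ?thesis
    using False by simp
qed

text \<open>Expanding each power gives a sum over all maps \<open>f\<close> from slots to slots with
  range inside \<open>J\<close>. The alternating sum over \<open>J\<close> keeps only the surjective
  \<open>f\<close>; these are the permutations, and each contributes the same product.\<close>

lemma prod_polarization: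
  fixes a :: "'p::finite \<Rightarrow> real"
  shows "(\<Sum>J\<in>Pow UNIV. (-1) ^ (CARD('p) - card J) * (\<Sum>q\<in>J. a q) ^ CARD('p))
    = fact CARD('p) * (\<Prod>q\<in>UNIV. a q)"
proof -
  let ?s = "\<lambda>J :: 'p set. (-1 :: real) ^ (CARD('p) - card J)"
  have expand: "(\<Sum>q\<in>J. a q) ^ CARD('p)
      = (\<Sum>f\<in>(UNIV :: ('p \<Rightarrow> 'p) set). of_bool (range f \<subseteq> J) * (\<Prod>q\<in>UNIV. a (f q)))" for J
  proof -
    have "(\<Sum>q\<in>J. a q) ^ CARD('p) = (\<Prod>q'\<in>(UNIV :: 'p set). \<Sum>q\<in>J. a q)"
      by simp
    also have "\<dots> = (\<Sum>f\<in>PiE (UNIV :: 'p set) (\<lambda>_. J). \<Prod>q\<in>UNIV. a (f q))"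
      by (rule prod_sum_PiE) auto
    also have "\<dots> = (\<Sum>f\<in>(UNIV :: ('p \<Rightarrow> 'p) set). of_bool (range f \<subseteq> J) * (\<Prod>q\<in>UNIV. a (f q)))"
      by (rule sum.mono_neutral_cong_left) (auto simp: PiE_UNIV_domain)
    finally show ?thesis .
  qed
  have "(\<Sum>J\<in>Pow UNIV. ?s J * (\<Sum>q\<in>J. a q) ^ CARD('p))
      = (\<Sum>J\<in>Pow UNIV. \<Sum>f\<in>(UNIV :: ('p \<Rightarrow> 'p) set).
           (?s J * of_bool (range f \<subseteq> J)) * (\<Prod>q\<in>UNIV. a (f q)))"
    by (simp only: expand sum_distrib_left mult.assoc)
  also have "\<dots> = (\<Sum>f\<in>(UNIV :: ('p \<Rightarrow> 'p) set).
           (\<Sum>J\<in>Pow UNIV. ?s J * of_bool (range f \<subseteq> J)) * (\<Prod>q\<in>UNIV. a (f q)))"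
    by (subst sum.swap) (simp only: sum_distrib_right)
  also have "\<dots> = (\<Sum>f\<in>(UNIV :: ('p \<Rightarrow> 'p) set). of_bool (range f = UNIV) * (\<Prod>q\<in>UNIV. a (f q)))"
  proof (rule sum.cong[OF refl])
    fix f :: "'p \<Rightarrow> 'p"
    have "(\<Sum>J\<in>Pow UNIV. ?s J * of_bool (range f \<subseteq> J)) = (\<Sum>J | J \<subseteq> UNIV \<and> range f \<subseteq> J. ?s J)"
      by (rule sum.mono_neutral_cong_right) auto
    then show "(\<Sum>J\<in>Pow UNIV. ?s J * of_bool (range f \<subseteq> J)) * (\<Prod>q\<in>UNIV. a (f q))
        = of_bool (range f = UNIV) * (\<Prod>q\<in>UNIV. a (f q))"
      using sum_alternating_supersets[of "UNIV :: 'p set" "range f"] by simp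
  qed
  also have "\<dots> = (\<Sum>f | f permutes (UNIV :: 'p set). \<Prod>q\<in>UNIV. a q)"
  proof (rule sum.mono_neutral_cong_right)
    have "f permutes UNIV" if "range f = UNIV" for f :: "'p \<Rightarrow> 'p"
      using that finite_UNIV_surj_inj[of f] by (intro bij_imp_permutes) (auto simp: bij_def)
    then show "\<forall>f\<in>UNIV - {f. f permutes (UNIV :: 'p set)}.
        of_bool (range f = UNIV) * (\<Prod>q\<in>UNIV. a (f q)) = 0"
      by auto
    fix f assume "f \<in> {f. f permutes (UNIV :: 'p set)}"
    then have "bij f"
      by (auto simp: permutes_bij)
    then show "of_bool (range f = UNIV) * (\<Prod>q\<in>UNIV. a (f q)) = (\<Prod>q\<in>UNIV. a q)"
      using prod.reindex_bij_betw[of f UNIV UNIV a] by (simp add: bij_is_surj)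
  qed auto
  also have "\<dots> = fact CARD('p) * (\<Prod>q\<in>UNIV. a q)"
    by (simp add: card_permutations)
  finally show ?thesis .
qed

text \<open>Both sides are linear in \<open>S\<close>, so it suffices to treat a tensor power, where
  the claim is the scalar identity \<open>prod_polarization\<close> for the numbers
  \<open>z \<bullet> w q\<close>.\<close>

lemma contract_polarization:
  fixes S :: "('p::finite, 'd::finite) tensor"
  assumes "S \<in> span (range tensor_pow)"
  shows "contract S w = 1 / fact CARD('p) *
    (\<Sum>J\<in>Pow UNIV. (-1) ^ (CARD('p) - card J) * contract S (\<lambda>_. \<Sum>j\<in>J. w j))"
  (is "_ = ?R S")
  using assms
proof (induction S rule: span_induct_alt)
  case base
  show ?case
    by (simp add: contract_eq_inner)
next
  case (step c S S')
  obtain z where z: "S = tensor_pow z"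
    using step by auto
  have "?R S = contract S w"
    using prod_polarization[of "\<lambda>q. z \<bullet> w q"]
    by (simp add: z contract_tensor_pow inner_sum_right)
  moreover have "?R (c *\<^sub>R S + S') = c * ?R S + ?R S'"
    by (simp add: contract_eq_inner inner_add_left sum.distrib sum_distrib_left algebra_simps)
  moreover have "contract (c *\<^sub>R S + S') w = c * contract S w + contract S' w"
    by (simp add: contract_eq_inner inner_add_left)
  ultimately show ?case
    using step by simp
qed

text \<open>The coefficients in the dual basis are inner products with the \<open>B r\<close>. When
  the \<open>B r\<close> are tensor powers, the coefficients of a tensor energy are thus scalar
  energies of projections.\<close>

lemma dual_basis:
  fixes B :: "'i \<Rightarrow> 'a::euclidean_space"
  assumes "finite I" "inj_on B I" "independent (B ` I)"
  obtains D where "\<And>r. D r \<in> span (B ` I)"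
    and "\<And>S. S \<in> span (B ` I) \<Longrightarrow> S = (\<Sum>r\<in>I. (S \<bullet> B r) *\<^sub>R D r)"
    and "\<And>r s. r \<in> I \<Longrightarrow> s \<in> I \<Longrightarrow> D r \<bullet> B s = of_bool (r = s)"
proof -
  have "\<exists>d. d \<in> span (B ` I) \<and> (\<forall>s\<in>I. r \<in> I \<longrightarrow> d \<bullet> B s = of_bool (r = s))" for r
  proof -
    obtain f :: "'a \<Rightarrow> real" where f: "linear f" "\<forall>y\<in>B ` I. f y = of_bool (y = B r)"
      using linear_independent_extend[OF assms(3), of "\<lambda>y. of_bool (y = B r)"] by auto
    \<comment> \<open>\<open>adjoint f 1\<close> is the vector that represents \<open>f\<close>;
      projecting it onto the span leaves its inner products with the \<open>B s\<close>
      unchanged.\<close>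
    obtain y z where yz: "y \<in> span (B ` I)" "\<And>w. w \<in> span (B ` I) \<Longrightarrow> orthogonal z w"
      "adjoint f 1 = y + z"
      by (rule orthogonal_subspace_decomp_exists[of "B ` I" "adjoint f 1"]) blast
    have "y \<bullet> B s = of_bool (r = s)" if "s \<in> I" "r \<in> I" for s
    proof -
      have "y \<bullet> B s = (y + z) \<bullet> B s"
        using yz(2)[of "B s"] that by (simp add: inner_add_left orthogonal_def span_base)
      also have "\<dots> = f (B s)"
        using adjoint_works[OF f(1), of "B s" 1] by (simp add: yz(3)[symmetric] inner_commute)
      also have "\<dots> = of_bool (r = s)"
        using f(2) that assms(2) by (auto simp: inj_on_def)
      finally show ?thesis .
    qed
    then show ?thesis
      using yz(1) by blast
  qed
  then obtain D where D: "\<And>r. D r \<in> span (B ` I)"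
    "\<And>r s. r \<in> I \<Longrightarrow> s \<in> I \<Longrightarrow> D r \<bullet> B s = of_bool (r = s)"
    by metis
  have "S = (\<Sum>r\<in>I. (S \<bullet> B r) *\<^sub>R D r)" if S: "S \<in> span (B ` I)" for S
  proof -
    \<comment> \<open>This difference lies in the span and is orthogonal to it, hence it is
      zero.\<close>
    let ?d = "S - (\<Sum>r\<in>I. (S \<bullet> B r) *\<^sub>R D r)"
    have "?d \<bullet> B s = 0" if "s \<in> I" for s
    proof -
      have "(\<Sum>r\<in>I. (S \<bullet> B r) *\<^sub>R D r) \<bullet> B s = (\<Sum>r\<in>I. if r = s then S \<bullet> B r else 0)"
        unfolding inner_sum_left by (rule sum.cong) (use D(2) that in auto)
      then show ?thesis
        using assms(1) that by (simp add: inner_diff_left)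
    qed
    then have "B ` I \<subseteq> {y. orthogonal ?d y}"
      by (auto simp: orthogonal_def)
    then have "span (B ` I) \<subseteq> {y. orthogonal ?d y}"
      by (rule span_minimal) (rule subspace_orthogonal_to_vector)
    moreover have "?d \<in> span (B ` I)"
      using S D(1) by (intro span_diff span_sum span_scale)
    ultimately show ?thesis
      by (auto simp: orthogonal_def)
  qed
  then show ?thesis
    using that D by blast
qed

section \<open>The cone of powers\<close>

text \<open>The slot type \<open>'k \<times> bool\<close> groups the 2k slots into k pairs. Slots
  \<open>(j, False)\<close> and \<open>(j, True)\<close> receive the same basis vector, so this is
  the complete pairwise trace.\<close>

definition tensor_trace :: "('k::finite \<times> bool, 'd::finite) tensor \<Rightarrow> real" where
  "tensor_trace S = (\<Sum>i\<in>UNIV. contract S (\<lambda>(j, b). axis (i j) 1))"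

lemma linear_contract: "linear (\<lambda>S. contract S w)"
  by (rule linearI) (simp_all add: contract_eq_inner inner_add_left)

lemma linear_tensor_trace: "linear tensor_trace"
  unfolding tensor_trace_def by (intro linear_compose_sum ballI linear_contract)

text \<open>The trace is the expansion over multi-indices of the k-th power of the sum of the
  squared coordinates.\<close>

lemma tensor_trace_tensor_pow:
  fixes z :: "real ^ 'd::finite"
  shows "tensor_trace (tensor_pow z :: ('k::finite \<times> bool, 'd) tensor) = norm z ^ (2 * CARD('k))"
proof -
  have "(\<Prod>q\<in>(UNIV :: ('k \<times> bool) set). z \<bullet> (case q of (j, b) \<Rightarrow> axis (i j) 1))
      = (\<Prod>j\<in>UNIV. (z $ i j)\<^sup>2)" for i
  proof -
    have "(\<Prod>q\<in>(UNIV :: ('k \<times> bool) set). z \<bullet> (case q of (j, b) \<Rightarrow> axis (i j) 1))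
        = (\<Prod>(j, b)\<in>(UNIV :: 'k set) \<times> (UNIV :: bool set). z $ i j)"
      by (intro prod.cong) (auto simp: inner_axis)
    also have "\<dots> = (\<Prod>j\<in>UNIV. \<Prod>b\<in>(UNIV :: bool set). z $ i j)"
      by (rule prod.cartesian_product[symmetric])
    finally show ?thesis
      by simp
  qed
  then have "tensor_trace (tensor_pow z :: ('k \<times> bool, 'd) tensor)
      = (\<Sum>i\<in>UNIV. \<Prod>j\<in>(UNIV :: 'k set). (z $ i j)\<^sup>2)"
    by (simp add: tensor_trace_def contract_tensor_pow)
  also have "\<dots> = (\<Prod>j\<in>(UNIV :: 'k set). \<Sum>c\<in>UNIV. (z $ c)\<^sup>2)"
    using prod_sum_PiE[of "UNIV :: 'k set" "\<lambda>_. UNIV" "\<lambda>j c. (z $ c)\<^sup>2"]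
    by (simp add: PiE_UNIV_domain)
  also have "(\<Sum>c\<in>UNIV. (z $ c)\<^sup>2) = (norm z)\<^sup>2"
    unfolding power2_norm_eq_inner inner_vec_def by (simp add: power2_eq_square)
  finally show ?thesis
    by (simp add: power_mult)
qed

text \<open>Since the norm is sublinear and the trace linear, the inequality defines a closed convex
  cone; it contains the tensor powers, where equality holds.\<close>

lemma norm_le_tensor_trace:
  fixes S :: "('k::finite \<times> bool, 'd::finite) tensor"
  assumes "S \<in> power_cone"
  shows "norm S \<le> tensor_trace S"
proof -
  let ?K = "{S :: ('k \<times> bool, 'd) tensor. norm S \<le> tensor_trace S}"
  have "convex_cone ?K"
    unfolding convex_cone_iff
    by (auto simp: linear_0[OF linear_tensor_trace] linear_add[OF linear_tensor_trace]
        linear_cmul[OF linear_tensor_trace] intro: norm_triangle_mono mult_left_mono)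
  then have "convex_cone hull range tensor_pow \<subseteq> ?K"
    by (intro hull_minimal) (auto simp: norm_tensor_pow tensor_trace_tensor_pow mult.commute)
  moreover have "closed ?K"
    by (intro closed_Collect_le continuous_intros
        linear_continuous_on linear_conv_bounded_linear[THEN iffD1, OF linear_tensor_trace])
  ultimately show ?thesis
    using assms closure_minimal[of "convex_cone hull range tensor_pow" ?K]
    by (auto simp: power_cone_def)
qed

text \<open>For even order, \<open>(z \<bullet> u) ^ CARD('p)\<close> is nonnegative, so all tensor
  powers lie in one closed half-space.\<close>

lemma power_cone_inner_nonneg:
  fixes S :: "('p::finite, 'd::finite) tensor"
  assumes "S \<in> power_cone" "even CARD('p)"
  shows "0 \<le> S \<bullet> tensor_pow u"
proof -
  let ?K = "{S :: ('p, 'd) tensor. tensor_pow u \<bullet> S \<ge> 0}"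
  have "convex_cone hull range tensor_pow \<subseteq> ?K"
    using assms(2)
    by (intro hull_minimal convex_cone_halfspace_ge) (auto simp: inner_tensor_pow)
  moreover have "closed ?K"
    by (rule closed_halfspace_ge)
  ultimately show ?thesis
    using assms(1) closure_minimal[of "convex_cone hull range tensor_pow" ?K]
    by (auto simp: power_cone_def inner_commute)
qed

section \<open>Limits along shifted grids\<close>

text \<open>The epsilon-delta form of the suprema in \<open>grid_vanishes\<close>, which avoids
  \<open>ennreal\<close>.\<close>

definition grid_bounded :: "real \<Rightarrow> real \<Rightarrow> real \<Rightarrow> (real set \<Rightarrow> real \<Rightarrow> real) \<Rightarrow> bool" where
  "grid_bounded T \<delta> \<epsilon> D \<longleftrightarrow>
     (\<forall>l a t. 0 < l \<and> l \<le> \<delta> \<and> 0 \<le> a \<and> a < l \<and> 0 \<le> t \<and> t \<le> T \<longrightarrow>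
        D (shifted_grid T l a) t \<le> \<epsilon>)"

lemma grid_boundedI:
  assumes "\<And>l a t. 0 < l \<Longrightarrow> l \<le> \<delta> \<Longrightarrow> 0 \<le> a \<Longrightarrow> a < l \<Longrightarrow> 0 \<le> t \<Longrightarrow> t \<le> T \<Longrightarrow>
    D (shifted_grid T l a) t \<le> \<epsilon>"
  shows "grid_bounded T \<delta> \<epsilon> D"
  using assms by (simp add: grid_bounded_def)

lemma grid_boundedD:
  assumes "grid_bounded T \<delta> \<epsilon> D" "0 < l" "l \<le> \<delta>" "0 \<le> a" "a < l" "0 \<le> t" "t \<le> T"
  shows "D (shifted_grid T l a) t \<le> \<epsilon>"
  using assms by (simp add: grid_bounded_def)

lemma grid_bounded_iff_SUP:
  assumes "0 \<le> \<epsilon>"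
  shows "grid_bounded T \<delta> \<epsilon> D \<longleftrightarrow>
    (SUP l\<in>{0<..\<delta>}. SUP a\<in>{0..<l}. SUP t\<in>{0..T}. ennreal (D (shifted_grid T l a) t)) \<le> ennreal \<epsilon>"
  using assms by (auto simp: grid_bounded_def SUP_le_iff ennreal_le_iff Ball_def)

lemma grid_vanishes_iff:
  "grid_vanishes T D \<longleftrightarrow> (\<forall>\<epsilon>>0. \<exists>\<delta>>0. grid_bounded T \<delta> \<epsilon> D)"
  (is "_ \<longleftrightarrow> ?R")
proof
  let ?S = "\<lambda>\<delta>. SUP l\<in>{0<..\<delta>}. SUP a\<in>{0..<l}. SUP t\<in>{0..T}. ennreal (D (shifted_grid T l a) t)"
  assume "grid_vanishes T D"
  then have lim: "(?S \<longlongrightarrow> 0) (at_right 0)"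
    by (simp add: grid_vanishes_def)
  show ?R
  proof (intro allI impI)
    fix \<epsilon> :: real
    assume "\<epsilon> > 0"
    then have "eventually (\<lambda>\<delta>. ?S \<delta> < ennreal \<epsilon>) (at_right 0)"
      by (intro order_tendstoD(2)[OF lim]) simp
    then obtain b :: real where b: "b > 0" "\<And>y. 0 < y \<Longrightarrow> y < b \<Longrightarrow> ?S y < ennreal \<epsilon>"
      unfolding eventually_at_right_field by auto
    have "?S (b / 2) \<le> ennreal \<epsilon>"
      using b by (intro less_imp_le) simp
    then show "\<exists>\<delta>>0. grid_bounded T \<delta> \<epsilon> D"
      using b(1) \<open>\<epsilon> > 0\<close> by (intro exI[of _ "b / 2"]) (simp add: grid_bounded_iff_SUP)
  qed
next
  let ?S = "\<lambda>\<delta>. SUP l\<in>{0<..\<delta>}. SUP a\<in>{0..<l}. SUP t\<in>{0..T}. ennreal (D (shifted_grid T l a) t)"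
  assume R: ?R
  have "eventually (\<lambda>\<delta>. ?S \<delta> < c) (at_right 0)" if "0 < c" for c :: ennreal
  proof -
    \<comment> \<open>An intermediate value is needed because \<open>c\<close> may be infinite,
      whereas \<open>e\<close> is below \<open>c\<close> and hence a real number.\<close>
    obtain e where e: "0 < e" "e < c"
      using dense[OF \<open>0 < c\<close>] by auto
    then obtain \<epsilon> where \<epsilon>: "\<epsilon> > 0" "e = ennreal \<epsilon>"
      by (cases e) auto
    obtain \<delta> where \<delta>: "\<delta> > 0" "grid_bounded T \<delta> \<epsilon> D"
      using R \<epsilon>(1) by blast
    have "?S y < c" if "y < \<delta>" for y
    proof -
      have "grid_bounded T y \<epsilon> D"
        using \<delta>(2) that by (force simp: grid_bounded_def)
      then show ?thesis
        using e(2) \<epsilon> by (simp add: grid_bounded_iff_SUP)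
    qed
    then show ?thesis
      unfolding eventually_at_right_field using \<delta>(1) by auto
  qed
  then show "grid_vanishes T D"
    unfolding grid_vanishes_def by (intro order_tendstoI) simp_all
qed

lemma grid_vanishesE:
  assumes "grid_vanishes T D" "\<epsilon> > 0"
  obtains \<delta> where "\<delta> > 0" "grid_bounded T \<delta> \<epsilon> D"
  using assms unfolding grid_vanishes_iff by blast

lemma grid_vanishes_mono:
  assumes "grid_vanishes T D" "\<And>P t. 0 \<le> t \<Longrightarrow> t \<le> T \<Longrightarrow> E P t \<le> D P t"
  shows "grid_vanishes T E"
proof -
  have "grid_bounded T \<delta> \<epsilon> E" if "grid_bounded T \<delta> \<epsilon> D" for \<delta> \<epsilon>
    by (rule grid_boundedI) (use assms(2) grid_boundedD[OF that] order_trans in blast)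
  then show ?thesis
    using assms(1) unfolding grid_vanishes_iff by blast
qed

lemma grid_vanishes_add:
  assumes "grid_vanishes T D" "grid_vanishes T E"
  shows "grid_vanishes T (\<lambda>P t. D P t + E P t)"
  unfolding grid_vanishes_iff
proof (intro allI impI)
  fix \<epsilon> :: real
  assume "\<epsilon> > 0"
  then have half: "\<epsilon> / 2 > 0"
    by simp
  obtain \<delta>1 where 1: "\<delta>1 > 0" "grid_bounded T \<delta>1 (\<epsilon> / 2) D"
    by (rule grid_vanishesE[OF assms(1) half])
  obtain \<delta>2 where 2: "\<delta>2 > 0" "grid_bounded T \<delta>2 (\<epsilon> / 2) E"
    by (rule grid_vanishesE[OF assms(2) half])
  have "grid_bounded T (min \<delta>1 \<delta>2) \<epsilon> (\<lambda>P t. D P t + E P t)"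
  proof (rule grid_boundedI)
    fix l a t
    assume "0 < l" "l \<le> min \<delta>1 \<delta>2" "0 \<le> a" "a < l" "0 \<le> t" "t \<le> T"
    then show "D (shifted_grid T l a) t + E (shifted_grid T l a) t \<le> \<epsilon>"
      using grid_boundedD[OF 1(2), of l a t] grid_boundedD[OF 2(2), of l a t] by simp
  qed
  then show "\<exists>\<delta>>0. grid_bounded T \<delta> \<epsilon> (\<lambda>P t. D P t + E P t)"
    using 1(1) 2(1) by (intro exI[of _ "min \<delta>1 \<delta>2"]) simp
qed

lemma grid_vanishes_cmult:
  assumes "grid_vanishes T D" "c \<ge> 0"
  shows "grid_vanishes T (\<lambda>P t. c * D P t)"
  unfolding grid_vanishes_iff
proof (intro allI impI)
  fix \<epsilon> :: real
  assume "\<epsilon> > 0"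
  \<comment> \<open>Dividing by \<open>c + 1\<close> instead of \<open>c\<close> covers
    \<open>c = 0\<close>.\<close>
  then have pos: "\<epsilon> / (c + 1) > 0"
    using assms(2) by simp
  obtain \<delta> where \<delta>: "\<delta> > 0" "grid_bounded T \<delta> (\<epsilon> / (c + 1)) D"
    by (rule grid_vanishesE[OF assms(1) pos])
  have "c * (\<epsilon> / (c + 1)) \<le> \<epsilon>"
    using assms(2) \<open>\<epsilon> > 0\<close> by (simp add: field_simps)
  then have "grid_bounded T \<delta> \<epsilon> (\<lambda>P t. c * D P t)"
    using mult_left_mono[OF grid_boundedD[OF \<delta>(2)] assms(2)]
    by (intro grid_boundedI) (meson order_trans)
  then show "\<exists>\<delta>>0. grid_bounded T \<delta> \<epsilon> (\<lambda>P t. c * D P t)"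
    using \<delta>(1) by blast
qed

lemma grid_vanishes_sum:
  assumes "\<And>r. r \<in> I \<Longrightarrow> grid_vanishes T (D r)"
  shows "grid_vanishes T (\<lambda>P t. \<Sum>r\<in>I. D r P t)"
proof -
  have zero: "grid_vanishes T (\<lambda>P t. 0)"
    unfolding grid_vanishes_iff grid_bounded_def by (auto intro: exI[of _ 1])
  show ?thesis
    using assms
    by (induction I rule: infinite_finite_induct) (simp_all add: zero grid_vanishes_add)
qed

lemma grid_vanishes_unique:
  fixes f g :: "real \<Rightarrow> 'a::real_normed_vector"
  assumes "grid_vanishes T (\<lambda>P t. norm (F P t - f t))"
    and "grid_vanishes T (\<lambda>P t. norm (F P t - g t))"
    and t: "t \<in> {0..T}"
  shows "f t = g t"
proof -
  have van: "grid_vanishes T (\<lambda>P t. norm (f t - g t))"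
    by (rule grid_vanishes_mono[OF grid_vanishes_add[OF assms(1,2)]])
      (metis norm_minus_commute norm_diff_triangle_le order_refl)
  have "norm (f t - g t) \<le> 0 + \<epsilon>" if pos: "\<epsilon> > 0" for \<epsilon>
  proof -
    obtain \<delta> where "\<delta> > 0" "grid_bounded T \<delta> \<epsilon> (\<lambda>P t. norm (f t - g t))"
      by (rule grid_vanishesE[OF van pos])
    \<comment> \<open>The bounded quantity does not depend on the grid, so a single admissible grid
      suffices.\<close>
    from grid_boundedD[OF this(2), of \<delta> 0 t] this(1) t show ?thesis
      by simp
  qed
  then have "norm (f t - g t) \<le> 0"
    by (rule field_le_epsilon)
  then show ?thesis
    by simp
qed

lemma has_energy_unique:
  assumes "has_energy T p y A" "has_energy T p y A'" "t \<in> {0..T}"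
  shows "A t = A' t"
  using assms grid_vanishes_unique[of T "\<lambda>P t. energy p P y t" A A' t]
  by (simp add: has_energy_def)

text \<open>Transfers the tensor limit to the energies of projections and to the Euclidean energy,
  both linear images of the tensor energy.\<close>

lemma grid_vanishes_linear:
  fixes f :: "'a::euclidean_space \<Rightarrow> real"
  assumes "linear f" "grid_vanishes T (\<lambda>P t. norm (F P t - Q t))"
  shows "grid_vanishes T (\<lambda>P t. \<bar>f (F P t) - f (Q t)\<bar>)"
proof -
  obtain K where K: "K \<ge> 0" "\<And>z. norm (f z) \<le> norm z * K"
    using bounded_linear.nonneg_bounded assms(1) linear_conv_bounded_linear by blast
  show ?thesis
    by (rule grid_vanishes_mono[OF grid_vanishes_cmult[OF assms(2) K(1)]])
      (use K(2) in \<open>simp add: mult.commute flip: linear_diff[OF assms(1)]\<close>)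
qed

text \<open>The shift is the remainder of \<open>s\<close> modulo \<open>l\<close>. This is where
  uniformity over shifts becomes useful: any prescribed time can be made a grid point.\<close>

lemma ex_shifted_grid_containing:
  assumes "0 \<le> s" "s \<le> T" "0 < l"
  shows "\<exists>a. 0 \<le> a \<and> a < l \<and> s \<in> shifted_grid T l a"
proof (intro exI conjI)
  let ?a = "s - of_int \<lfloor>s / l\<rfloor> * l"
  have "of_int \<lfloor>s / l\<rfloor> * l \<le> s"
    using of_int_floor_le[of "s / l"] unfolding pos_le_divide_eq[OF assms(3)] .
  moreover have "s < (of_int \<lfloor>s / l\<rfloor> + 1) * l"
    using conjunct2[OF floor_correct[of "s / l"]]
    unfolding pos_divide_less_eq[OF assms(3)] of_int_add of_int_1 .
  ultimately show "0 \<le> ?a" "?a < l"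
    by (simp_all add: algebra_simps)
  \<comment> \<open>The endpoints are set apart because they belong to every grid by
    definition.\<close>
  have "\<exists>k :: int. s = ?a + of_int k * l \<and> 0 < ?a + of_int k * l \<and> ?a + of_int k * l < T"
    if "s \<noteq> 0" "s \<noteq> T"
    using assms that by (intro exI[of _ "\<lfloor>s / l\<rfloor>"]) simp
  then show "s \<in> shifted_grid T l ?a"
    unfolding shifted_grid_def by blast
qed

section \<open>Tensor energies along partitions\<close>

lemma node_in: "finite P \<Longrightarrow> j < card P \<Longrightarrow> node P j \<in> P"
  using nth_mem[of j "sorted_list_of_set P"] by (simp add: node_def)

lemma node_mono: "i \<le> j \<Longrightarrow> j < card P \<Longrightarrow> node P i \<le> node P j"
  unfolding node_def by (simp add: sorted_nth_mono)

lemma ex_node: "finite P \<Longrightarrow> s \<in> P \<Longrightarrow> \<exists>m<card P. node P m = s"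
  using in_set_conv_nth[of s "sorted_list_of_set P"] by (auto simp: node_def)

lemma node_extremes:
  assumes "finite P" "{0, T} \<subseteq> P" "P \<subseteq> {0..T}"
  shows "node P 0 = 0" "node P (card P - 1) = T"
proof -
  obtain i j where ij: "i < card P" "node P i = 0" "j < card P" "node P j = T"
    using ex_node[OF assms(1), of 0] ex_node[OF assms(1), of T] assms(2) by auto
  have "node P 0 \<in> {0..T}" "node P (card P - 1) \<in> {0..T}"
    using node_in[OF assms(1)] assms(3) ij(1) by (auto simp: subset_iff)
  then show "node P 0 = 0" "node P (card P - 1) = T"
    using node_mono[of 0 i P] node_mono[of j "card P - 1" P] ij by auto
qed

lemma tensor_energy_sym: "tensor_energy P x t \<in> sym_tensors"
  unfolding tensor_energy_def by (intro subspace_sum subspace_sym_tensors tensor_pow_sym)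

lemma energy_projection:
  fixes x :: "real \<Rightarrow> real ^ 'd"
  assumes "even CARD('p::finite)"
  shows "energy CARD('p) P (\<lambda>t. u \<bullet> x t) t
    = (tensor_energy P x t :: ('p, 'd) tensor) \<bullet> tensor_pow u"
  using assms
  by (simp add: energy_def tensor_energy_def inner_sum_left inner_tensor_pow
      inner_commute[of u] inner_diff_left power_even_abs)

lemma energy_eq_tensor_trace:
  "energy (2 * CARD('k)) P x t = tensor_trace (tensor_energy P x t :: ('k::finite \<times> bool, 'd::finite) tensor)"
  by (simp add: energy_def tensor_energy_def linear_sum[OF linear_tensor_trace] tensor_trace_tensor_pow)

lemma convex_cone_hull_sum:
  "(\<And>j. j \<in> I \<Longrightarrow> f j \<in> convex_cone hull S) \<Longrightarrow> sum f I \<in> convex_cone hull S"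
  by (induction I rule: infinite_finite_induct)
    (auto simp: convex_cone_hull_contains_0 convex_cone_hull_add)

text \<open>As \<open>s\<close> is a node, no interval straddles it. Intervals before
  \<open>s\<close> contribute equally at both times and cancel; later ones contribute nothing at
  time \<open>s\<close>, leaving a single tensor power each.\<close>

lemma tensor_energy_increment:
  fixes x :: "real \<Rightarrow> real ^ 'd::finite"
  assumes "finite P" "s \<in> P" "s \<le> t"
  shows "(tensor_energy P x t :: ('p::finite, 'd) tensor) - tensor_energy P x s
    \<in> convex_cone hull range tensor_pow"
proof -
  let ?z = "\<lambda>j t. x (min (node P (Suc j)) t) - x (min (node P j) t)"
  obtain m where m: "m < card P" "node P m = s"
    using ex_node[OF assms(1,2)] by auto
  have "(tensor_pow (?z j t) :: ('p, 'd) tensor) - tensor_pow (?z j s) \<in> convex_cone hull range tensor_pow"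
    if "j < card P - 1" for j
  proof (cases "j < m")
    case True
    then have "node P j \<le> s" "node P (Suc j) \<le> s"
      using node_mono[of j m P] node_mono[of "Suc j" m P] m by auto
    then show ?thesis
      using assms(3) by (simp add: convex_cone_hull_contains_0)
  next
    case False
    then have "s \<le> node P j" "s \<le> node P (Suc j)"
      using node_mono[of m j P] node_mono[of m "Suc j" P] m that by auto
    then have "?z j s = 0"
      by (simp add: min_def)
    then show ?thesis
      by (simp add: hull_inc)
  qed
  then show ?thesis
    unfolding tensor_energy_def sum_subtractf[symmetric] by (intro convex_cone_hull_sum) auto
qed

text \<open>Among the grids of spacing \<open>l\<close> there is one passing through \<open>s\<close>; along it the tensor energy
  picks up only full tensor powers between \<open>s\<close> and \<open>t\<close>.\<close>

lemma limit_increment_in_power_cone: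
  fixes x :: "real \<Rightarrow> real ^ 'd::finite" and Q :: "real \<Rightarrow> ('p::finite, 'd) tensor"
  assumes "grid_vanishes T (\<lambda>P t. norm (tensor_energy P x t - Q t))"
    and "0 \<le> s" "s \<le> t" "t \<le> T"
  shows "Q t - Q s \<in> power_cone"
  unfolding power_cone_def closure_approachable
proof (intro allI impI)
  fix e :: real
  assume "e > 0"
  then have pos: "e / 3 > 0"
    by simp
  \<comment> \<open>The threshold itself serves as the grid spacing.\<close>
  obtain l where l: "l > 0" "grid_bounded T l (e / 3) (\<lambda>P t. norm (tensor_energy P x t - Q t))"
    by (rule grid_vanishesE[OF assms(1) pos])
  obtain a where a: "0 \<le> a" "a < l" "s \<in> shifted_grid T l a"
    using ex_shifted_grid_containing[of s T l] assms l by auto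
  let ?E = "tensor_energy (shifted_grid T l a) x :: real \<Rightarrow> ('p, 'd) tensor"
  have "dist (?E t - ?E s) (Q t - Q s) = norm ((?E t - Q t) - (?E s - Q s))"
    by (simp add: dist_norm algebra_simps)
  also have "\<dots> \<le> norm (?E t - Q t) + norm (?E s - Q s)"
    by (rule norm_triangle_ineq4)
  also have "\<dots> \<le> e / 3 + e / 3"
    using grid_boundedD[OF l(2,1) order_refl a(1,2)] assms by (intro add_mono) auto
  also have "\<dots> < e"
    using \<open>e > 0\<close> by simp
  finally show "\<exists>y\<in>convex_cone hull range tensor_pow. dist y (Q t - Q s) < e"
    using tensor_energy_increment[of "shifted_grid T l a" s t x] finite_shifted_grid[OF l(1)] a assms
    by blast
qed

text \<open>The trace dominates the norm of each increment and is linear, so the bound telescopes to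
  a quantity independent of the partition.\<close>

lemma bounded_variation_of_power_cone:
  fixes Q :: "real \<Rightarrow> ('k::finite \<times> bool, 'd::finite) tensor"
  assumes "\<And>s t. 0 \<le> s \<Longrightarrow> s \<le> t \<Longrightarrow> t \<le> T \<Longrightarrow> Q t - Q s \<in> power_cone"
  shows "bounded_variation T Q"
  unfolding bounded_variation_def
proof (intro exI allI impI)
  fix P
  assume P: "finite P \<and> {0, T} \<subseteq> P \<and> P \<subseteq> {0..T}"
  let ?f = "\<lambda>j. tensor_trace (Q (node P j))"
  have "norm (Q (node P (Suc j)) - Q (node P j)) \<le> ?f (Suc j) - ?f j" if "j < card P - 1" for j
  proof -
    have "node P j \<in> P" "node P (Suc j) \<in> P" "node P j \<le> node P (Suc j)"
      using P that by (auto intro!: node_in node_mono)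
    then have "Q (node P (Suc j)) - Q (node P j) \<in> power_cone"
      using P by (intro assms) auto
    then show ?thesis
      using norm_le_tensor_trace linear_diff[OF linear_tensor_trace] by metis
  qed
  then have "(\<Sum>j<card P - 1. norm (Q (node P (Suc j)) - Q (node P j)))
      \<le> (\<Sum>j<card P - 1. ?f (Suc j) - ?f j)"
    by (intro sum_mono) auto
  also have "\<dots> = tensor_trace (Q T) - tensor_trace (Q 0)"
    using node_extremes[of P T] P sum_lessThan_telescope[of ?f "card P - 1"] by simp
  finally show "(\<Sum>j<card P - 1. norm (Q (node P (Suc j)) - Q (node P j)))
      \<le> tensor_trace (Q T) - tensor_trace (Q 0)" .
qed

lemma norm_on_sum_le:
  assumes "norm_on V \<nu>" "subspace V" "\<And>r. r \<in> I \<Longrightarrow> D r \<in> V"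
  shows "\<nu> (\<Sum>r\<in>I. c r *\<^sub>R D r) \<le> (\<Sum>r\<in>I. \<bar>c r\<bar> * \<nu> (D r))"
proof -
  have "\<nu> 0 = 0"
    using assms(1) subspace_0[OF assms(2)] by (auto simp: norm_on_def)
  then show ?thesis
    using assms(3)
  proof (induction I rule: infinite_finite_induct)
  case (insert r I)
  \<comment> \<open>The axioms in \<open>norm_on\<close> concern members of \<open>V\<close> only,
    so the partial sums must be shown to stay there.\<close>
  have "c r *\<^sub>R D r \<in> V" "(\<Sum>r\<in>I. c r *\<^sub>R D r) \<in> V"
    using insert.prems by (auto intro!: subspace_sum subspace_scale assms(2))
  then have "\<nu> (c r *\<^sub>R D r + (\<Sum>r\<in>I. c r *\<^sub>R D r)) \<le> \<nu> (c r *\<^sub>R D r) + \<nu> (\<Sum>r\<in>I. c r *\<^sub>R D r)"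
    using assms(1) by (simp add: norm_on_def)
  moreover have "\<nu> (c r *\<^sub>R D r) = \<bar>c r\<bar> * \<nu> (D r)"
    using assms(1) insert.prems by (simp add: norm_on_def)
  ultimately show ?case
    using insert by simp
qed simp_all
qed

section \<open>The limiting tensor energy\<close>

theorem proposition8p4:
  fixes T :: real and p k N :: nat
    and x :: "real \<Rightarrow> real ^ 'd"
    and v :: "nat \<Rightarrow> real ^ 'd"
    and A :: "nat \<Rightarrow> real \<Rightarrow> real"
  assumes "T > 0"
    and "k = CARD('k::finite)" and "p = 2 * k"
    and "continuous_on {0..T} x"
    and "N = dim (sym_tensors :: ('k \<times> bool, 'd) tensor set)"
    and "inj_on (\<lambda>r. tensor_pow (v r) :: ('k \<times> bool, 'd) tensor) {1..N}"
    and "independent ((\<lambda>r. tensor_pow (v r) :: ('k \<times> bool, 'd) tensor) ` {1..N})"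
    and "span ((\<lambda>r. tensor_pow (v r) :: ('k \<times> bool, 'd) tensor) ` {1..N}) = sym_tensors"
    and "\<forall>r\<in>{1..N}. continuous_on {0..T} (A r) \<and> (\<forall>t\<in>{0..T}. 0 \<le> A r t) \<and> A r 0 = 0"
    and "\<forall>r\<in>{1..N}. has_energy T p (\<lambda>t. x t \<bullet> v r) (A r)"
  shows "N = (CARD('d) + p - 1) choose p \<and>
    (\<exists>Q :: real \<Rightarrow> ('k \<times> bool, 'd) tensor.
       is_tensor_energy T x Q \<and>
       (\<forall>Q' :: real \<Rightarrow> ('k \<times> bool, 'd) tensor.
          is_tensor_energy T x Q' \<longrightarrow> (\<forall>t\<in>{0..T}. Q' t = Q t)) \<and>
       (let Av = (\<lambda>u t. contract (Q t) (\<lambda>_. u));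
            Asc = (\<lambda>t. \<Sum>i\<in>(UNIV :: ('k \<Rightarrow> 'd) set).
                      contract (Q t) (\<lambda>(j, b). axis (i j) 1))
        in
          (\<forall>u. continuous_on {0..T} (Av u) \<and> has_energy T p (\<lambda>t. u \<bullet> x t) (Av u)) \<and>
          (\<forall>r\<in>{1..N}. \<forall>t\<in>{0..T}. Av (v r) t = A r t) \<and>

          (\<forall>t\<in>{0..T}. Av 0 t = 0) \<and>
          (\<forall>w :: 'k \<times> bool \<Rightarrow> real ^ 'd. \<forall>t\<in>{0..T}.
             contract (Q t) w =
               1 / fact p * (\<Sum>J\<in>Pow UNIV. (-1) ^ (p - card J) * Av (\<Sum>j\<in>J. w j) t)) \<and>

          (\<forall>s t. 0 \<le> s \<and> s < t \<and> t \<le> T \<longrightarrow> Q t - Q s \<in> power_cone) \<and>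
          (\<forall>u. mono_on {0..T} (Av u)) \<and>

          has_energy T p x Asc \<and>
          (\<forall>r\<in>{1..N}. A r T > 0 \<longleftrightarrow> p_rough T p (\<lambda>t. x t \<bullet> v r)) \<and>
          ((\<exists>r\<in>{1..N}. A r T > 0) \<longrightarrow>
             x \<in> rough_sc T p \<and> (\<forall>t\<in>{0..T}. bracket_sc T p x t = Asc t))))"
proof -
  note T = assms(1) and x = assms(4) and inj = assms(6) and ind = assms(7) and gen = assms(8)
  have card: "CARD('k \<times> bool) = p"
    using assms(2,3) by simp
  have even: "even CARD('k \<times> bool)"
    by simp
  have A: "continuous_on {0..T} (A r)" "A r 0 = 0" "has_energy T p (\<lambda>t. x t \<bullet> v r) (A r)"
    if "r \<in> {1..N}" for r
    using assms(9,10) that by auto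
  let ?B = "\<lambda>r. tensor_pow (v r) :: ('k \<times> bool, 'd) tensor"
  let ?E = "\<lambda>P. tensor_energy P x :: real \<Rightarrow> ('k \<times> bool, 'd) tensor"

  \<comment> \<open>Construction of the limit from the dual basis\<close>
  have proj: "energy p P (\<lambda>t. u \<bullet> x t) t = ?E P t \<bullet> tensor_pow u" for P u t
    using energy_projection[OF even] unfolding card .
  obtain D where D_span: "\<And>r. D r \<in> span (?B ` {1..N})"
    and D_repr: "\<And>S. S \<in> span (?B ` {1..N}) \<Longrightarrow> S = (\<Sum>r\<in>{1..N}. (S \<bullet> ?B r) *\<^sub>R D r)"
    and D_dual: "\<And>r s. r \<in> {1..N} \<Longrightarrow> s \<in> {1..N} \<Longrightarrow> D r \<bullet> ?B s = of_bool (r = s)"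
    by (rule dual_basis[OF finite_atLeastAtMost inj ind]) blast
  have D: "D r \<in> sym_tensors" for r
    using D_span gen by simp
  \<comment> \<open>The dual coordinates of the tensor energy are the energies of the
    \<open>x t \<bullet> v r\<close>, so their limits \<open>A r\<close> must be the coordinates of
    the limit.\<close>
  define Q where "Q t = (\<Sum>r\<in>{1..N}. A r t *\<^sub>R D r)" for t
  have Q_sym: "Q t \<in> sym_tensors" for t
    unfolding Q_def by (intro subspace_sum subspace_scale subspace_sym_tensors D)
  have Q_cont: "continuous_on {0..T} Q"
    unfolding Q_def by (intro continuous_intros A)
  have Q_0: "Q 0 = 0"
    unfolding Q_def by (intro sum.neutral) (simp add: A)
  have Q_A: "Q t \<bullet> ?B s = A s t" if "s \<in> {1..N}" for s t
  proof -
    have "Q t \<bullet> ?B s = (\<Sum>r\<in>{1..N}. if r = s then A r t else 0)"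
      unfolding Q_def inner_sum_left by (rule sum.cong) (use D_dual that in auto)
    then show ?thesis
      using that by simp
  qed

  \<comment> \<open>Convergence, increments and uniqueness\<close>
  have lim: "grid_vanishes T (\<lambda>P t. \<nu> (?E P t - Q t))"
    if \<nu>: "norm_on (sym_tensors :: ('k \<times> bool, 'd) tensor set) \<nu>" for \<nu>
  proof (rule grid_vanishes_mono)
    let ?e = "\<lambda>r P t. \<bar>energy p P (\<lambda>t. x t \<bullet> v r) t - A r t\<bar>"
    show "grid_vanishes T (\<lambda>P t. \<Sum>r\<in>{1..N}. \<nu> (D r) * ?e r P t)"
      using A(3) \<nu> D
      by (intro grid_vanishes_sum grid_vanishes_cmult) (auto simp: has_energy_def norm_on_def)
    fix P t
    have "?E P t = (\<Sum>r\<in>{1..N}. (?E P t \<bullet> ?B r) *\<^sub>R D r)"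
      using gen tensor_energy_sym by (intro D_repr) blast
    also have "\<dots> = (\<Sum>r\<in>{1..N}. energy p P (\<lambda>t. x t \<bullet> v r) t *\<^sub>R D r)"
      by (simp add: inner_commute[of "x _"] proj)
    finally have "?E P t - Q t = (\<Sum>r\<in>{1..N}. (energy p P (\<lambda>t. x t \<bullet> v r) t - A r t) *\<^sub>R D r)"
      by (simp add: Q_def sum_subtractf scaleR_diff_left)
    then show "\<nu> (?E P t - Q t) \<le> (\<Sum>r\<in>{1..N}. \<nu> (D r) * ?e r P t)"
      unfolding mult.commute[of "\<nu> _"]
      by (simp only:) (rule norm_on_sum_le[OF \<nu> subspace_sym_tensors D])
  qed
  have norm: "norm_on (sym_tensors :: ('k \<times> bool, 'd) tensor set) norm"
    by (auto simp: norm_on_def norm_triangle_ineq)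
  note limn = lim[OF norm]
  have cone: "Q t - Q s \<in> power_cone" if "0 \<le> s" "s \<le> t" "t \<le> T" for s t
    using limit_increment_in_power_cone[OF limn that] .
  have is_Q: "is_tensor_energy T x Q"
    unfolding is_tensor_energy_def
    using Q_sym Q_cont Q_0 lim bounded_variation_of_power_cone[of T Q] cone by blast
  have unique: "Q' t = Q t" if "is_tensor_energy T x Q'" "t \<in> {0..T}" for Q' t
    using that norm by (intro grid_vanishes_unique[OF _ limn]) (auto simp: is_tensor_energy_def)

  \<comment> \<open>Energies of linear projections and the polarization formula\<close>
  define Av where "Av = (\<lambda>u t. contract (Q t) (\<lambda>_. u))"
  define Asc where "Asc = (\<lambda>t. \<Sum>i\<in>(UNIV :: ('k \<Rightarrow> 'd) set).
      contract (Q t) (\<lambda>(j, b). axis (i j) 1))"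
  have Asc_trace: "Asc t = tensor_trace (Q t)" for t
    by (simp add: Asc_def tensor_trace_def)
  have Av_inner: "Av u t = Q t \<bullet> tensor_pow u" for u t
    by (simp add: Av_def contract_diagonal)
  have Av_cont: "continuous_on {0..T} (Av u)" for u
    unfolding Av_inner by (intro continuous_intros Q_cont)
  have Av_energy: "has_energy T p (\<lambda>t. u \<bullet> x t) (Av u)" for u
    using grid_vanishes_linear[OF bounded_linear.linear[OF bounded_linear_inner_left] limn,
        of "tensor_pow u"]
    by (simp add: has_energy_def Av_inner proj)
  have Av_v: "Av (v r) t = A r t" if "r \<in> {1..N}" for r t
    using Q_A[OF that] by (simp add: Av_inner)
  have Av_0: "Av 0 t = 0" for t
    by (simp add: Av_inner)
  have Av_mono: "mono_on {0..T} (Av u)" for u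
  proof (rule mono_onI)
    fix s t
    assume "s \<in> {0..T}" "t \<in> {0..T}" "s \<le> t"
    then have "0 \<le> (Q t - Q s) \<bullet> tensor_pow u"
      using cone[of s t] by (intro power_cone_inner_nonneg even) auto
    then show "Av u s \<le> Av u t"
      by (simp add: Av_inner inner_diff_left)
  qed
  have polar: "contract (Q t) w =
      1 / fact p * (\<Sum>J\<in>Pow UNIV. (-1) ^ (p - card J) * Av (\<Sum>j\<in>J. w j) t)" for w t
  proof -
    \<comment> \<open>Symmetric tensors are spanned by powers by assumption, so polarization applies
      to \<open>Q t\<close>.\<close>
    have "span (?B ` {1..N}) \<subseteq> span (range tensor_pow)"
      by (intro span_mono) auto
    then have "Q t \<in> span (range tensor_pow)"
      using Q_sym gen by blast
    then show ?thesis
      unfolding Av_def card[symmetric] by (rule contract_polarization)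
  qed

  \<comment> \<open>The Euclidean energy and roughness\<close>
  have Asc_energy: "has_energy T p x Asc"
    using grid_vanishes_linear[OF linear_tensor_trace limn]
    by (simp add: has_energy_def Asc_trace assms(2,3) energy_eq_tensor_trace)
  have Asc_incr: "norm (Q t - Q s) \<le> Asc t - Asc s" if "0 \<le> s" "s \<le> t" "t \<le> T" for s t
    using norm_le_tensor_trace[OF cone[OF that]] by (simp add: Asc_trace linear_diff[OF linear_tensor_trace])
  have Asc_cont: "continuous_on {0..T} Asc"
    unfolding Asc_trace
    by (intro linear_continuous_on_compose[OF Q_cont] linear_tensor_trace)
  have Asc_0: "Asc 0 = 0"
    by (simp add: Asc_trace Q_0 linear_0[OF linear_tensor_trace])
  have Asc_le: "Asc s \<le> Asc t" if "0 \<le> s" "s \<le> t" "t \<le> T" for s t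
    using order_trans[OF norm_ge_zero Asc_incr[OF that]] by simp
  then have Asc_mono: "mono_on {0..T} Asc"
    by (auto intro: mono_onI)
  have Asc_rough: "has_rough_energy T p x Asc" if r: "r \<in> {1..N}" "A r T > 0" for r
  proof -
    \<comment> \<open>A positive \<open>A r T\<close> forces \<open>Q T\<close> to be nonzero, and
      the trace dominates its norm.\<close>
    have "0 < norm (Q T - Q 0)"
      using Q_A[OF r(1), of T] r(2) by (auto simp: Q_0)
    also have "\<dots> \<le> Asc T"
      using Asc_incr[of 0 T] T by (simp add: Asc_0)
    finally have "0 < Asc T" .
    moreover have "\<forall>t\<in>{0..T}. 0 \<le> Asc t"
      using Asc_le[of 0] by (auto simp: Asc_0)
    ultimately show ?thesis
      using Asc_cont Asc_mono Asc_0 Asc_energy by (simp add: has_rough_energy_def)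
  qed
  have sc: "x \<in> rough_sc T p \<and> (\<forall>t\<in>{0..T}. bracket_sc T p x t = Asc t)"
    if r: "r \<in> {1..N}" "A r T > 0" for r
  proof -
    \<comment> \<open>The bracket is an arbitrary choice among rough energies; uniqueness of limits
      identifies it with \<open>Asc\<close> on \<open>{0..T}\<close>.\<close>
    have "has_rough_energy T p x (bracket_sc T p x)"
      unfolding bracket_sc_def by (rule someI[of "has_rough_energy T p x", OF Asc_rough[OF r]])
    then have "has_energy T p x (bracket_sc T p x)"
      by (simp add: has_rough_energy_def)
    then show ?thesis
      using has_energy_unique[OF _ Asc_energy] Asc_rough[OF r] x by (auto simp: rough_sc_def)
  qed
  have rough_iff: "A r T > 0 \<longleftrightarrow> p_rough T p (\<lambda>t. x t \<bullet> v r)" if r: "r \<in> {1..N}" for r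
  proof
    assume "A r T > 0"
    moreover have "mono_on {0..T} (A r)"
      \<comment> \<open>Monotonicity of \<open>A r\<close> is inherited from the limit tensor
        through \<open>Av (v r)\<close>.\<close>
      using Av_mono[of "v r"] Av_v[OF r] by (simp add: mono_on_def)
    moreover have "\<forall>t\<in>{0..T}. 0 \<le> A r t"
      using assms(9) r by blast
    ultimately have "has_rough_energy T p (\<lambda>t. x t \<bullet> v r) (A r)"
      using A[OF r] by (simp add: has_rough_energy_def)
    then show "p_rough T p (\<lambda>t. x t \<bullet> v r)"
      unfolding p_rough_def by (auto intro!: continuous_intros x)
  next
    assume "p_rough T p (\<lambda>t. x t \<bullet> v r)"
    then obtain A' where A': "has_rough_energy T p (\<lambda>t. x t \<bullet> v r) A'"
      by (auto simp: p_rough_def)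
    then have "A r T = A' T"
      using has_energy_unique[OF A(3)[OF r], of A' T] T by (simp add: has_rough_energy_def)
    then show "A r T > 0"
      using A' by (simp add: has_rough_energy_def)
  qed

  have "N = (CARD('d) + p - 1) choose p"
    using dim_sym_tensors[where 'p = "'k \<times> bool" and 'd = 'd] assms(5) card by simp
  then show ?thesis
  \<comment> \<open>Goal 4 is the \<open>let\<close> block; the others are the dimension formula,
    the limit property and uniqueness.\<close>
  proof (intro conjI exI[of _ Q], goal_cases)
    case 4
    show ?case
      unfolding Av_def[symmetric] Asc_def[symmetric] Let_def
    proof (intro conjI allI impI ballI)
      fix s t
      assume "0 \<le> s \<and> s < t \<and> t \<le> T"
      then show "Q t - Q s \<in> power_cone"
        by (intro cone) auto
    next
      fix w :: "'k \<times> bool \<Rightarrow> real ^ 'd" and t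
      show "contract (Q t) w =
          1 / fact p * (\<Sum>J\<in>Pow UNIV. (-1) ^ (p - card J) * Av (\<Sum>j\<in>J. w j) t)"
        by (rule polar)
    qed (use Av_cont Av_energy Av_v Av_0 Av_mono Asc_energy sc rough_iff in blast)+
  qed (use is_Q unique in blast)+
qed

end
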